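(* There exists a randomized algorithm that, given a positive integer $k$, a value $\varepsilon\in(0,1)$, and value-oracle access to a non-negative submodular function $f\colon 2^{\mathcal{N}}\to\mathbb{R}$ (with $|\mathcal{N}|=n$), outputs a set $S\subseteq\mathcal{N}$ with $|S|\le k$ which, with probability at least $1-\varepsilon$, satisfies \[ f(S)\ \ge\ \frac{f(S\cap\mathrm{OPT})+f(S\cup\mathrm{OPT})}{2+\varepsilon}\qquad\text{and}\qquad f(S)\ \ge\ \frac{f(S\cap\mathrm{OPT})}{1+\varepsilon}, \] where $\mathrm{OPT}\in\arg\max\{f(T): T\subseteq\mathcal{N},\,|T|\le k\}$. The number of value-oracle queries made by the algorithm is $O_\varepsilon(n+k^2)$, i.e., at most $C_\varepsilon(n+k^2)$ for a constant $C_\varepsilon$ depending only on $\varepsilon$.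
   Context: A set function $f\colon 2^{\mathcal{N}}\to\mathbb{R}$ is submodular if $f(A\cup\{s\})-f(A)\ge f(B\cup\{s\})-f(B)$ for all $A\subseteq B\subseteq\mathcal{N}$ and $s\in\mathcal{N}\setminus B$; non-negative means $f\ge 0$. A value-oracle query returns $f(A)$ for a queried set $A$. *)

theory Defs
  imports "HOL-Probability.Probability"
begin

text \<open>Deterministic value-oracle algorithms as (possibly infinitely branching) query trees:
  either stop and output a set, or query the oracle on a set and continue depending
  on the real value returned.\<close>
datatype 'a qtree = Return "'a set" | Query "'a set" "real \<Rightarrow> 'a qtree"

primrec qt_output :: "('a set \<Rightarrow> real) \<Rightarrow> 'a qtree \<Rightarrow> 'a set" where
  "qt_output f (Return S) = S"
| "qt_output f (Query A g) = qt_output f (g (f A))"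

primrec qt_queries :: "('a set \<Rightarrow> real) \<Rightarrow> 'a qtree \<Rightarrow> nat" where
  "qt_queries f (Return S) = 0"
| "qt_queries f (Query A g) = Suc (qt_queries f (g (f A)))"

definition submodular_on :: "'a set \<Rightarrow> ('a set \<Rightarrow> real) \<Rightarrow> bool" where
  "submodular_on V f \<longleftrightarrow>
     (\<forall>A B s. A \<subseteq> B \<and> B \<subseteq> V \<and> s \<in> V - B \<longrightarrow>
        f (insert s A) - f A \<ge> f (insert s B) - f B)"

definition nonneg_on :: "'a set \<Rightarrow> ('a set \<Rightarrow> real) \<Rightarrow> bool" where
  "nonneg_on V f \<longleftrightarrow> (\<forall>A. A \<subseteq> V \<longrightarrow> f A \<ge> 0)"

definition is_opt :: "'a set \<Rightarrow> nat \<Rightarrow> ('a set \<Rightarrow> real) \<Rightarrow> 'a set \<Rightarrow> bool" where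
  "is_opt V k f O' \<longleftrightarrow> O' \<subseteq> V \<and> card O' \<le> k \<and>
     (\<forall>T. T \<subseteq> V \<and> card T \<le> k \<longrightarrow> f T \<le> f O')"

end

theory Submission
  imports Defs
begin

text \<open>
  One pass over the ground set grows two disjoint lists, giving each element to the list where its
  gain is larger, provided that this gain exceeds a \<open>1/k\<close> fraction of the current value. The value
  of a list doubles over its last \<open>k\<close> insertions, so by subadditivity these last \<open>k\<close> elements carry
  half of the value; combined with the rejection rule and disjointness, the better of the two
  tails \<open>S\<^sub>0\<close> satisfies \<open>f(OPT) \<le> 16 f(S\<^sub>0)\<close>.

  The local search starting at \<open>S\<^sub>0\<close> draws a single uniform element per step and tries to exchange it
  for the element of \<open>S\<close> whose removal hurts least, accepting only gains above
  \<open>\<tau> = \<epsilon> f(S\<^sub>0) / (4k)\<close>. The cheapest element is recomputed, at \<open>k\<close> queries, only after an accepted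
  move, and there are at most \<open>64 k / \<epsilon>\<close> of these because all values are at most \<open>16 f(S\<^sub>0)\<close>. At
  a set violating the guarantee the expected gain of one step is at least
  \<open>\<epsilon> f(S\<^sub>0) / (4 (n + k))\<close>, so among \<open>64 (n + k) / \<epsilon>\<^sup>2\<close> steps only an \<open>\<epsilon>\<close> fraction, in
  expectation, can be at such sets; hence stopping at a uniformly random step succeeds with
  probability at least \<open>1 - \<epsilon>\<close>.
\<close>

subsection \<open>Batched queries\<close>

text \<open>The continuation receives a function that agrees with \<open>f\<close> on the asked sets
  and is 0 elsewhere, so the functions of the analysis run unchanged inside a tree while seeing only
  queried values.\<close>

primrec asks :: "'a set list \<Rightarrow> (('a set \<Rightarrow> real) \<Rightarrow> 'a qtree) \<Rightarrow> 'a qtree" where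
  "asks [] c = c (\<lambda>_. 0)"
| "asks (X # Xs) c = Query X (\<lambda>r. asks Xs (\<lambda>g. c (g(X := r))))"

definition table :: "('a set \<Rightarrow> real) \<Rightarrow> 'a set list \<Rightarrow> 'a set \<Rightarrow> real" where
  "table f Xs = (\<lambda>X. if X \<in> set Xs then f X else 0)"

lemma table_Cons: "table f (X # Xs) = (table f Xs)(X := f X)"
  by (auto simp: table_def)

lemma qt_output_asks [simp]: "qt_output f (asks Xs c) = qt_output f (c (table f Xs))"
  by (induction Xs arbitrary: c) (simp_all add: table_Cons, simp add: table_def)

lemma qt_queries_asks [simp]:
  "qt_queries f (asks Xs c) = length Xs + qt_queries f (c (table f Xs))"
  by (induction Xs arbitrary: c) (simp_all add: table_Cons, simp add: table_def)

declare asks.simps [simp del]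

definition enum :: "'a set \<Rightarrow> 'a list" where
  "enum S = (SOME xs. set xs = S \<and> distinct xs)"

lemma
  assumes "finite S"
  shows set_enum: "set (enum S) = S" and distinct_enum: "distinct (enum S)"
    and length_enum: "length (enum S) = card S"
proof -
  have *: "set (enum S) = S \<and> distinct (enum S)"
    unfolding enum_def by (rule someI_ex) (use finite_distinct_list[OF assms] in blast)
  show "set (enum S) = S" "distinct (enum S)" using * by simp_all
  show "length (enum S) = card S" using * distinct_card by metis
qed


subsection \<open>The algorithm\<close>

text \<open>Lists record the insertion order, newest first, so that \<open>take k\<close> later
  selects the last \<open>k\<close> insertions.\<close>

definition place :: "('a set \<Rightarrow> real) \<Rightarrow> nat \<Rightarrow> 'a \<Rightarrow> 'a list \<times> 'a list \<Rightarrow> 'a list \<times> 'a list" where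
  "place f k x = (\<lambda>(A, B).
     let a = f (insert x (set A)) - f (set A); b = f (insert x (set B)) - f (set B) in
     if b \<le> a then if a > f (set A) / k then (x # A, B) else (A, B)
     else if b > f (set B) / k then (A, x # B) else (A, B))"

primrec scan ::
  "nat \<Rightarrow> 'a list \<Rightarrow> 'a list \<times> 'a list \<Rightarrow> ('a list \<times> 'a list \<Rightarrow> 'a qtree) \<Rightarrow> 'a qtree" where
  "scan k [] AB c = c AB"
| "scan k (x # xs) AB c =
     asks [set (fst AB), insert x (set (fst AB)), set (snd AB), insert x (set (snd AB))]
       (\<lambda>g. scan k xs (place g k x AB) c)"

text \<open>For \<open>S = {}\<close> the choice is unspecified but harmless, since then
  \<open>S - {v} = S\<close>.\<close>

definition weakest :: "('a set \<Rightarrow> real) \<Rightarrow> 'a set \<Rightarrow> 'a" where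
  "weakest f S = (SOME v. v \<in> S \<and> (\<forall>w\<in>S. f (S - {w}) \<le> f (S - {v})))"

text \<open>The element \<open>v\<close> is a parameter so that \<open>search\<close> can cache it
  between moves. The deletion test comes first and ignores \<open>u\<close>.\<close>

definition move :: "('a set \<Rightarrow> real) \<Rightarrow> nat \<Rightarrow> real \<Rightarrow> 'a \<Rightarrow> 'a set \<Rightarrow> 'a \<Rightarrow> 'a set" where
  "move f k \<tau> v S u =
     (let T = insert u (if card S < k then S else S - {v}) in
      if f (S - {v}) > f S + \<tau> then S - {v} else if f T > f S + \<tau> then T else S)"

primrec search :: "nat \<Rightarrow> real \<Rightarrow> 'a list \<Rightarrow> 'a set \<Rightarrow> 'a \<Rightarrow> 'a qtree" where
  "search k \<tau> [] S v = Return S"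
| "search k \<tau> (u # us) S v =
     asks [S, S - {v}, insert u S, insert u (S - {v})] (\<lambda>g.
       let S' = move g k \<tau> v S u in
       if S' = S then search k \<tau> us S v
       else asks (map (\<lambda>w. S' - {w}) (enum S')) (\<lambda>h. search k \<tau> us S' (weakest h S')))"

definition better :: "('a set \<Rightarrow> real) \<Rightarrow> 'a set \<Rightarrow> 'a set \<Rightarrow> 'a set" where
  "better f A B = (if f B \<le> f A then A else B)"

definition local_search_tree :: "'a set \<Rightarrow> nat \<Rightarrow> real \<Rightarrow> 'a list \<Rightarrow> 'a qtree" where
  "local_search_tree V k \<epsilon> us =
     scan k (enum V) ([], []) (\<lambda>(A, B).
       asks [set (take k A), set (take k B)] (\<lambda>g.
         let S = better g (set (take k A)) (set (take k B)) in
         asks (map (\<lambda>w. S - {w}) (enum S)) (\<lambda>h.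
           search k (\<epsilon> * g S / (4 * k)) us S (weakest h S))))"

text \<open>The expected number of visits to bad sets is at most
  \<open>64 * (card V + k) / \<epsilon>\<close>; one more factor \<open>1 / \<epsilon>\<close> makes
  this an \<epsilon> fraction of all steps.\<close>

definition num_steps :: "'a set \<Rightarrow> nat \<Rightarrow> real \<Rightarrow> nat" where
  "num_steps V k \<epsilon> = nat \<lceil>64 * real (card V + k) / \<epsilon>\<^sup>2\<rceil>"

text \<open>All randomness is drawn up front, a stopping time and then that many elements; the tree
  is deterministic. The empty ground set is separate because it carries no uniform
  distribution.\<close>

definition local_search :: "'a set \<Rightarrow> nat \<Rightarrow> real \<Rightarrow> 'a qtree pmf" where
  "local_search V k \<epsilon> =
     (if V = {} then return_pmf (Return {})
      else bind_pmf (pmf_of_set {..<num_steps V k \<epsilon>}) (\<lambda>i.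
        map_pmf (local_search_tree V k \<epsilon>) (replicate_pmf i (pmf_of_set V))))"


subsection \<open>What the algorithm computes\<close>

lemma qt_scan:
  "qt_output f (scan k xs AB c) = qt_output f (c (fold (place f k) xs AB))"
  "qt_queries f (scan k xs AB c) = 4 * length xs + qt_queries f (c (fold (place f k) xs AB))"
proof (induction xs arbitrary: AB)
  case (Cons x xs)
  have *: "place (table f [set (fst AB), insert x (set (fst AB)), set (snd AB), insert x (set (snd AB))]) k x AB
      = place f k x AB" for AB
    by (cases AB) (simp add: place_def table_def)
  { case 1 show ?case using Cons by (simp add: *) }
  { case 2 show ?case using Cons by (simp add: *) }
qed auto

text \<open>Both functions agree on the queried sets, so the choice predicates coincide and
  \<open>SOME\<close> returns the same element even under ties.\<close>

lemma weakest_table: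
  assumes "finite S"
  shows "weakest (table f (map (\<lambda>w. S - {w}) (enum S))) S = weakest f S"
proof -
  have "table f (map (\<lambda>w. S - {w}) (enum S)) (S - {w}) = f (S - {w})" if "w \<in> S" for w
    using that by (auto simp: table_def set_enum[OF assms])
  then have "(v \<in> S \<and> (\<forall>w\<in>S. table f (map (\<lambda>w. S - {w}) (enum S)) (S - {w})
        \<le> table f (map (\<lambda>w. S - {w}) (enum S)) (S - {v})))
      = (v \<in> S \<and> (\<forall>w\<in>S. f (S - {w}) \<le> f (S - {v})))" for v
    by (metis (no_types, lifting))
  then show ?thesis unfolding weakest_def by presburger
qed

lemma weakest:
  assumes "finite S" "w \<in> S"
  shows "weakest f S \<in> S" "f (S - {w}) \<le> f (S - {weakest f S})"
proof -
  have "\<exists>v. v \<in> S \<and> (\<forall>w\<in>S. f (S - {w}) \<le> f (S - {v}))"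
    using obtains_MAX[OF assms(1), of "\<lambda>w. f (S - {w})"] assms
    by (metis Max_ge empty_iff finite_imageI image_eqI)
  from someI_ex[OF this, folded weakest_def]
  have "weakest f S \<in> S \<and> (\<forall>w\<in>S. f (S - {w}) \<le> f (S - {weakest f S}))" .
  then show "weakest f S \<in> S" "f (S - {w}) \<le> f (S - {weakest f S})"
    using assms(2) by simp_all
qed

definition step :: "('a set \<Rightarrow> real) \<Rightarrow> nat \<Rightarrow> real \<Rightarrow> 'a set \<Rightarrow> 'a \<Rightarrow> 'a set" where
  "step f k \<tau> S u = move f k \<tau> (weakest f S) S u"

lemma move_table:
  "move (table f [S, S - {v}, insert u S, insert u (S - {v})]) k \<tau> v S u = move f k \<tau> v S u"
  by (simp add: move_def table_def Let_def)

lemma step_gain: "step f k \<tau> S u = S \<or> f (step f k \<tau> S u) > f S + \<tau>"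
  by (auto simp: step_def move_def Let_def)

lemma step_cases:
  "step f k \<tau> S u = S \<or> step f k \<tau> S u = S - {weakest f S} \<or> step f k \<tau> S u = insert u (S - {weakest f S})
    \<or> step f k \<tau> S u = insert u S \<and> card S < k"
  by (auto simp: step_def move_def Let_def)

lemma step_feasible:
  assumes "finite V" "u \<in> V" "S \<subseteq> V" "card S \<le> k" "0 < k"
  shows "step f k \<tau> S u \<subseteq> V" "card (step f k \<tau> S u) \<le> k"
proof -
  have fin: "finite S" using assms finite_subset by blast
  show "step f k \<tau> S u \<subseteq> V"
    using step_cases[of f k \<tau> S u] assms by auto
  have 1: "card (insert u (S - {weakest f S})) \<le> k"
  \<comment> \<open>An empty \<open>S\<close> gives a singleton, which fits because
    \<open>0 < k\<close>; otherwise \<open>weakest f S\<close> lies in \<open>S\<close> and frees a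
    place.\<close>
  proof (cases "S = {}")
    case False
    then have "weakest f S \<in> S" using weakest(1)[OF fin] by blast
    then have "card (S - {weakest f S}) = card S - 1" "card S > 0"
      using fin by (auto simp: card_gt_0_iff)
    then show ?thesis using fin assms card_insert_le_m1[of k "S - {weakest f S}" u] by simp
  qed (use assms in simp)
  have 2: "card (S - {weakest f S}) \<le> k"
    using assms fin card_Diff1_le[of S "weakest f S"] by simp
  have 3: "card (insert u S) \<le> k" if "card S < k"
    using that fin by (simp add: card_insert_if)
  show "card (step f k \<tau> S u) \<le> k"
    using step_cases[of f k \<tau> S u] assms(4) 1 2 3 by (elim disjE) auto
qed

lemma foldl_step_feasible:
  assumes "finite V" "set us \<subseteq> V" "S \<subseteq> V" "card S \<le> k" "0 < k"
  shows "foldl (step f k \<tau>) S us \<subseteq> V \<and> card (foldl (step f k \<tau>) S us) \<le> k"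
  using assms(2-4)
proof (induction us arbitrary: S)
  case (Cons u us)
  then show ?case using step_feasible[OF assms(1) _ _ _ assms(5)] by simp
qed simp

lemma qt_output_search:
  assumes "finite S"
  shows "qt_output f (search k \<tau> us S (weakest f S)) = foldl (step f k \<tau>) S us"
  using assms
proof (induction us arbitrary: S)
  case (Cons u us)
  have "finite (step f k \<tau> S u)"
    using step_cases[of f k \<tau> S u] Cons.prems by (elim disjE) simp_all
  with Cons show ?case
    by (simp add: Let_def move_table weakest_table flip: step_def)
qed simp

text \<open>Amortisation: every move that triggers a recomputation of the weakest element costs
  \<^term>\<open>k\<close> further queries but pays \<^term>\<open>\<tau>\<close> of the remaining budget \<^term>\<open>M * \<tau>\<close>.\<close>

lemma qt_queries_search:
  fixes M \<tau> :: real
  assumes V: "finite V" "0 < k" and "0 \<le> \<tau>" "0 \<le> M" "S \<subseteq> V" "card S \<le> k" "set us \<subseteq> V"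
    and F: "\<And>T. T \<subseteq> V \<Longrightarrow> card T \<le> k \<Longrightarrow> f T \<le> F" and "F - f S \<le> M * \<tau>"
  shows "real (qt_queries f (search k \<tau> us S (weakest f S))) \<le> 4 * real (length us) + real k * M"
  using assms(4-7,9)
proof (induction us arbitrary: S M)
  case (Cons u us)
  define S' where "S' = step f k \<tau> S u"
  have S': "S' \<subseteq> V" "card S' \<le> k"
    using step_feasible[OF V(1) _ _ _ V(2)] Cons.prems by (auto simp: S'_def)
  then have fin: "finite S'" using V finite_subset by blast
  show ?case
  proof (cases "S' = S")
    case True
    then show ?thesis using Cons.IH[OF Cons.prems(1-3) _ Cons.prems(5)] Cons.prems(4)
      by (simp add: Let_def move_table flip: step_def S'_def)
  next
    case False
    then have gain: "f S' > f S + \<tau>"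
      using step_gain[of f k \<tau> S u] by (auto simp: S'_def)
    then have lt: "F - f S' < (M - 1) * \<tau>" using Cons.prems by (simp add: algebra_simps)
    \<comment> \<open>The gain is taken from a budget that cannot become negative, so
      \<open>M\<close> exceeds 1 and one unit can pay for the recomputation.\<close>
    moreover have "0 \<le> F - f S'" using F[OF S'] by simp
    ultimately have "0 < (M - 1) * \<tau>" by linarith
    then have M: "0 \<le> M - 1" using assms(3) by (simp add: zero_less_mult_iff)
    have "real (qt_queries f (search k \<tau> us S' (weakest f S'))) \<le> 4 * real (length us) + real k * (M - 1)"
      using Cons.IH[OF M S'] Cons.prems(4) lt by simp
    moreover have "qt_queries f (search k \<tau> (u # us) S (weakest f S)) =
        4 + card S' + qt_queries f (search k \<tau> us S' (weakest f S'))"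
      using False
      by (simp add: Let_def move_table weakest_table[OF fin] length_enum[OF fin] flip: step_def S'_def)
    ultimately show ?thesis using S'(2) by (simp add: algebra_simps)
  qed
qed (use assms in simp)


subsection \<open>Non-negative submodular functions\<close>

locale nonneg_submodular =
  fixes V :: "'a set" and f :: "'a set \<Rightarrow> real"
  assumes finite_ground: "finite V" and nonneg_f: "nonneg_on V f" and submodular_f: "submodular_on V f"
begin

lemma nonneg: "A \<subseteq> V \<Longrightarrow> 0 \<le> f A"
  using nonneg_f by (auto simp: nonneg_on_def)

lemma gain_antimono:
  "A \<subseteq> B \<Longrightarrow> B \<subseteq> V \<Longrightarrow> s \<in> V \<Longrightarrow> s \<notin> B \<Longrightarrow> f (insert s B) - f B \<le> f (insert s A) - f A"
  using submodular_f by (auto simp: submodular_on_def)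

lemma finite_subset_ground: "A \<subseteq> V \<Longrightarrow> finite A"
  using finite_ground finite_subset by blast

text \<open>Insert the elements of \<open>U - S\<close> one at a time; each gains no more than it
  would on \<open>S\<close> alone.\<close>

lemma union_gain_le:
  assumes "S \<subseteq> V" "U \<subseteq> V"
  shows "f (S \<union> U) - f S \<le> (\<Sum>u\<in>U - S. f (insert u S) - f S)"
proof -
  have "f (S \<union> X) - f S \<le> (\<Sum>u\<in>X. f (insert u S) - f S)" if "finite X" "X \<subseteq> U - S" for X
    using that
  proof (induction X rule: finite_induct)
    case (insert x X)
    have "f (insert x (S \<union> X)) - f (S \<union> X) \<le> f (insert x S) - f S"
      using insert assms by (intro gain_antimono) auto
    then show ?case using insert by simp
  qed simp
  from this[of "U - S"] show ?thesis
    using finite_subset_ground[of "U - S"] assms by (auto simp: Un_Diff_cancel)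
qed

text \<open>Delete the elements of \<open>S - U\<close> one at a time; no deletion is more
  profitable late than from the full \<open>S\<close>.\<close>

lemma removal_gain_le:
  assumes "S \<subseteq> V"
  shows "f (S \<inter> U) - f S \<le> (\<Sum>v\<in>S - U. f (S - {v}) - f S)"
proof -
  have "f (S - X) - f S \<le> (\<Sum>v\<in>X. f (S - {v}) - f S)" if "finite X" "X \<subseteq> S" for X
    using that
  proof (induction X rule: finite_induct)
    case (insert x X)
    have "f (insert x (S - {x})) - f (S - {x}) \<le> f (insert x (S - insert x X)) - f (S - insert x X)"
      using insert assms by (intro gain_antimono) auto
    moreover have "insert x (S - {x}) = S" "insert x (S - insert x X) = S - X"
      using insert by auto
    ultimately show ?case using insert by simp
  qed simp
  from this[of "S - U"] show ?thesis
    using finite_subset_ground[of "S - U"] assms by (auto simp: Diff_Diff_Int)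
qed

text \<open>The lattice form of submodularity: growing both \<open>A\<close> and
  \<open>A \<inter> B\<close> by \<open>B - A\<close>, element by element, favours the smaller
  set.\<close>

lemma union_inter_le:
  assumes "A \<subseteq> V" "B \<subseteq> V"
  shows "f (A \<union> B) + f (A \<inter> B) \<le> f A + f B"
proof -
  have "f (A \<union> X) - f A \<le> f (A \<inter> B \<union> X) - f (A \<inter> B)" if "finite X" "X \<subseteq> B - A" for X
    using that
  proof (induction X rule: finite_induct)
    case (insert x X)
    have "f (insert x (A \<union> X)) - f (A \<union> X) \<le> f (insert x (A \<inter> B \<union> X)) - f (A \<inter> B \<union> X)"
      using insert assms by (intro gain_antimono) auto
    then show ?case using insert by simp
  qed simp
  from this[of "B - A"] finite_subset_ground[of "B - A"] assms
  have "f (A \<union> (B - A)) - f A \<le> f (A \<inter> B \<union> (B - A)) - f (A \<inter> B)" by auto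
  moreover have "A \<union> (B - A) = A \<union> B" "A \<inter> B \<union> (B - A) = B" by auto
  ultimately show ?thesis by simp
qed


subsection \<open>The constant-factor approximation\<close>

primrec growing :: "nat \<Rightarrow> 'a list \<Rightarrow> bool" where
  "growing k [] \<longleftrightarrow> True"
| "growing k (x # A) \<longleftrightarrow> growing k A \<and> f (set A) / k \<le> f (insert x (set A)) - f (set A)"

text \<open>Each of the last \<open>j\<close> insertions adds at least a \<open>1 / k\<close>
  fraction of a value no smaller than that of \<open>drop j A\<close>. The case \<open>j = k\<close>
  gives doubling.\<close>

lemma growing_drop:
  assumes "growing k A" "set A \<subseteq> V" "j \<le> length A"
  shows "(1 + j / k) * f (set (drop j A)) \<le> f (set A)"
  using assms
proof (induction A arbitrary: j)
  case (Cons x A)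
  show ?case
  proof (cases j)
    case (Suc i)
    have IH: "(1 + i / k) * f (set (drop i A)) \<le> f (set A)"
      using Cons Suc by simp
    have D: "0 \<le> f (set (drop i A))"
      using Cons.prems set_drop_subset[of i A] by (intro nonneg) auto
    then have "1 * f (set (drop i A)) \<le> (1 + i / k) * f (set (drop i A))"
      by (intro mult_right_mono) auto
    with IH have "f (set (drop i A)) / k \<le> f (set A) / k"
      by (intro divide_right_mono) auto
    moreover have "f (set A) + f (set A) / k \<le> f (set (x # A))"
      using Cons.prems by simp
    moreover have "(1 + j / k) * f (set (drop j (x # A))) =
        (1 + i / k) * f (set (drop i A)) + f (set (drop i A)) / k"
      using Suc by (simp add: field_simps add_divide_distrib)
    ultimately show ?thesis using IH by linarith
  qed simp
qed simp

text \<open>The older part \<open>drop k A\<close> has at most half of the value, so subadditivity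
  leaves the other half to \<open>take k A\<close>.\<close>

lemma growing_take:
  assumes "growing k A" "set A \<subseteq> V" "0 < k"
  shows "f (set A) \<le> 2 * f (set (take k A))"
proof (cases "k \<le> length A")
  case True
  have "2 * f (set (drop k A)) \<le> f (set A)"
    using growing_drop[OF assms(1,2) True] assms(3) by simp
  moreover have "f (set (take k A) \<union> set (drop k A)) + f (set (take k A) \<inter> set (drop k A))
      \<le> f (set (take k A)) + f (set (drop k A))"
    using assms(2) set_take_subset[of k A] set_drop_subset[of k A] by (intro union_inter_le) auto
  moreover have "set (take k A) \<union> set (drop k A) = set A"
    by (metis append_take_drop_id set_append)
  moreover have "0 \<le> f (set (take k A) \<inter> set (drop k A))"
    using assms(2) set_take_subset[of k A] by (intro nonneg) auto
  ultimately show ?thesis by simp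
next
  case False
  then show ?thesis using nonneg[OF assms(2)] by simp
qed

text \<open>\<open>P\<close> is the scanned part. The first clause handles rejected elements; its
  bound contains both values because the rejection may have been decided at \<open>B\<close>. The
  second charges the elements of \<open>B\<close> to \<open>f B\<close>; truncation at 0 lets the
  sum be restricted to subsets.\<close>

definition saturated :: "nat \<Rightarrow> 'a set \<Rightarrow> 'a set \<Rightarrow> 'a set \<Rightarrow> bool" where
  "saturated k P A B \<longleftrightarrow>
     (\<forall>x\<in>P - A - B. f (insert x A) - f A \<le> (f A + f B) / k) \<and>
     (\<Sum>x\<in>B. max 0 (f (insert x A) - f A)) \<le> f B"

text \<open>Enlarging \<open>A\<close> only lowers the gains over it, while its value does not drop,
  so both clauses survive.\<close>

lemma saturated_insert_left:
  assumes "saturated k P A B" "insert x P \<subseteq> V" "x \<notin> P" "A \<subseteq> P" "B \<subseteq> P" "A \<inter> B = {}"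
    "f A \<le> f (insert x A)"
  shows "saturated k (insert x P) (insert x A) B"
proof -
  have gain: "f (insert y (insert x A)) - f (insert x A) \<le> f (insert y A) - f A"
    if "y \<in> P - A" for y
    using that assms by (intro gain_antimono) auto
  have "f (insert y (insert x A)) - f (insert x A) \<le> (f (insert x A) + f B) / k"
    if "y \<in> insert x P - insert x A - B" for y
  proof -
    have "f (insert y (insert x A)) - f (insert x A) \<le> (f A + f B) / k"
      using gain[of y] assms(1) that by (force simp: saturated_def)
    also have "\<dots> \<le> (f (insert x A) + f B) / k"
      using assms by (intro divide_right_mono) auto
    finally show ?thesis .
  qed
  moreover have "(\<Sum>y\<in>B. max 0 (f (insert y (insert x A)) - f (insert x A)))
      \<le> (\<Sum>y\<in>B. max 0 (f (insert y A) - f A))"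
    using assms by (intro sum_mono max.mono gain) auto
  ultimately show ?thesis using assms(1) by (auto simp: saturated_def)
qed

text \<open>The new summand, the truncated gain of \<open>x\<close> over \<open>A\<close>, is paid
  for by the increase from \<open>f B\<close> to \<open>f (insert x B)\<close>.\<close>

lemma saturated_insert_right:
  assumes "saturated k P A B" "insert x P \<subseteq> V" "x \<notin> P" "A \<subseteq> P" "B \<subseteq> P"
    "f (insert x A) - f A \<le> f (insert x B) - f B" "f B \<le> f (insert x B)"
  shows "saturated k (insert x P) A (insert x B)"
proof -
  have "f (insert y A) - f A \<le> (f A + f (insert x B)) / k"
    if "y \<in> insert x P - A - insert x B" for y
  proof -
    have "f (insert y A) - f A \<le> (f A + f B) / k"
      using assms(1) that by (auto simp: saturated_def)
    also have "\<dots> \<le> (f A + f (insert x B)) / k"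
      using assms by (intro divide_right_mono) auto
    finally show ?thesis .
  qed
  moreover have "finite B" "x \<notin> B" using assms finite_subset_ground by blast+
  ultimately show ?thesis using assms(1,6,7) by (auto simp: saturated_def)
qed

lemma saturated_skip:
  assumes "saturated k P A B" "f (insert x A) - f A \<le> (f A + f B) / k"
  shows "saturated k (insert x P) A B"
  using assms by (auto simp: saturated_def)

definition scan_inv :: "nat \<Rightarrow> 'a set \<Rightarrow> 'a list \<times> 'a list \<Rightarrow> bool" where
  "scan_inv k P = (\<lambda>(A, B). growing k A \<and> growing k B \<and> set A \<subseteq> P \<and> set B \<subseteq> P \<and>
     set A \<inter> set B = {} \<and> saturated k P (set A) (set B) \<and> saturated k P (set B) (set A))"

lemma scan_inv_place:
  assumes "scan_inv k P AB" "insert x P \<subseteq> V" "x \<notin> P"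
  shows "scan_inv k (insert x P) (place f k x AB)"
proof -
  obtain A B where AB: "AB = (A, B)" by force
  have inv: "growing k A" "growing k B" "set A \<subseteq> P" "set B \<subseteq> P" "set A \<inter> set B = {}"
    "saturated k P (set A) (set B)" "saturated k P (set B) (set A)"
    using assms(1) by (auto simp: AB scan_inv_def)
  have pos: "0 \<le> f (set A) / k" "0 \<le> f (set B) / k"
    using inv assms(2) by (auto intro!: divide_nonneg_nonneg nonneg)
  define a where "a = f (insert x (set A)) - f (set A)"
  define b where "b = f (insert x (set B)) - f (set B)"
  have place: "place f k x AB = (if b \<le> a then if a > f (set A) / k then (x # A, B) else (A, B)
     else if b > f (set B) / k then (A, x # B) else (A, B))"
    by (simp add: AB place_def a_def b_def)
  \<comment> \<open>An element is skipped when the larger gain is at most a \<open>1 / k\<close>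
    fraction of that list's value; both gains then obey the common bound.\<close>
  consider (left) "b \<le> a" "a > f (set A) / k" | (right) "a \<le> b" "b > f (set B) / k" "\<not> b \<le> a"
    | (skip) "a \<le> (f (set A) + f (set B)) / k" "b \<le> (f (set A) + f (set B)) / k"
        "place f k x AB = (A, B)"
  proof (cases "b \<le> a \<and> a > f (set A) / k \<or> a \<le> b \<and> b > f (set B) / k \<and> \<not> b \<le> a")
    case True
    then show thesis using that(1,2) by blast
  next
    case False
    then show thesis using pos by (intro that(3)) (auto simp: place add_divide_distrib)
  qed
  then show ?thesis
  proof cases
    case left
    then have "saturated k (insert x P) (insert x (set A)) (set B)"
      "saturated k (insert x P) (set B) (insert x (set A))"
      using inv assms pos
      by (auto intro!: saturated_insert_left saturated_insert_right simp: a_def b_def)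
    then show ?thesis using left inv assms unfolding place by (auto simp: scan_inv_def a_def)
  next
    case right
    then have "saturated k (insert x P) (insert x (set B)) (set A)"
      "saturated k (insert x P) (set A) (insert x (set B))"
      using inv assms pos
      by (auto intro!: saturated_insert_left saturated_insert_right simp: a_def b_def)
    then show ?thesis using right inv assms unfolding place by (auto simp: scan_inv_def b_def)
  next
    case skip
    then have "saturated k (insert x P) (set A) (set B)" "saturated k (insert x P) (set B) (set A)"
      using inv by (auto intro!: saturated_skip simp: a_def b_def add.commute)
    then show ?thesis using skip(3) inv by (auto simp: scan_inv_def)
  qed
qed

lemma scan_inv_fold:
  assumes "scan_inv k P AB" "P \<union> set xs \<subseteq> V" "distinct xs" "P \<inter> set xs = {}"
  shows "scan_inv k (P \<union> set xs) (fold (place f k) xs AB)"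
  using assms
proof (induction xs arbitrary: P AB)
  case (Cons x xs)
  have "scan_inv k (insert x P) (place f k x AB)"
    using Cons.prems by (intro scan_inv_place) auto
  from Cons.IH[OF this] Cons.prems show ?case by simp
qed simp

text \<open>Elements of \<open>U\<close> held by \<open>B\<close> gain at most \<open>f B\<close> in
  total; the rejected ones, at most \<open>k\<close> of them, gain at most
  \<open>f A + f B\<close>.\<close>

lemma saturated_union:
  assumes "saturated k V A B" "A \<subseteq> V" "B \<subseteq> V" "U \<subseteq> V" "card U \<le> k" "0 < k"
  shows "f (A \<union> U) \<le> 2 * (f A + f B)"
proof -
  have fin: "finite U" "finite B" using assms finite_subset_ground by blast+
  have pos: "0 \<le> (f A + f B) / k" using assms by (intro divide_nonneg_nonneg add_nonneg_nonneg nonneg) auto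
  have "f (A \<union> U) - f A \<le> (\<Sum>u\<in>U - A. f (insert u A) - f A)"
    using assms by (intro union_gain_le) auto
  also have "U - A = ((U - A) \<inter> B) \<union> (U - A - B)" by auto
  also have "(\<Sum>u\<in>\<dots>. f (insert u A) - f A) =
      (\<Sum>u\<in>(U - A) \<inter> B. f (insert u A) - f A) + (\<Sum>u\<in>U - A - B. f (insert u A) - f A)"
    using fin by (intro sum.union_disjoint) auto
  also have "(\<Sum>u\<in>U - A - B. f (insert u A) - f A) \<le> real (card (U - A - B)) * ((f A + f B) / k)"
    using assms by (intro sum_bounded_above) (auto simp: saturated_def)
  also have "\<dots> \<le> k * ((f A + f B) / k)"
  proof -
    have "U - A - B \<subseteq> U" by auto
    from card_mono[OF fin(1) this] show ?thesis
      using pos assms(5) by (intro mult_right_mono) auto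
  qed
  also have "\<dots> = f A + f B" using assms(6) by simp
  also have "(\<Sum>u\<in>(U - A) \<inter> B. f (insert u A) - f A)
      \<le> (\<Sum>u\<in>(U - A) \<inter> B. max 0 (f (insert u A) - f A))"
    by (intro sum_mono) auto
  also have "\<dots> \<le> (\<Sum>u\<in>B. max 0 (f (insert u A) - f A))"
    using fin by (intro sum_mono2) auto
  also have "\<dots> \<le> f B" using assms(1) by (simp add: saturated_def)
  finally show ?thesis by simp
qed

definition start :: "nat \<Rightarrow> 'a set" where
  "start k = (let (A, B) = fold (place f k) (enum V) ([], []) in
     better f (set (take k A)) (set (take k B)))"

text \<open>Disjointness gives \<open>f U \<le> f (A \<union> U) + f (B \<union> U) \<le> 4 * (f A +
  f B)\<close> for the two lists read as sets. Passing to the tails doubles the factor, and taking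
  the better tail doubles it again, hence 16.\<close>

lemma start:
  assumes "0 < k"
  shows "start k \<subseteq> V" "card (start k) \<le> k"
    and "\<And>U. U \<subseteq> V \<Longrightarrow> card U \<le> k \<Longrightarrow> f U \<le> 16 * f (start k)"
proof -
  obtain A B where AB: "fold (place f k) (enum V) ([], []) = (A, B)" by force
  have "scan_inv k {} ([], [])"
    using nonneg[of "{}"] by (simp add: scan_inv_def saturated_def)
  from scan_inv_fold[OF this, of "enum V"] have "scan_inv k V (A, B)"
    using finite_ground by (simp add: set_enum distinct_enum AB)
  then have inv: "growing k A" "growing k B" "set A \<subseteq> V" "set B \<subseteq> V" "set A \<inter> set B = {}"
    "saturated k V (set A) (set B)" "saturated k V (set B) (set A)"
    by (auto simp: scan_inv_def)
  have start_eq: "start k = better f (set (take k A)) (set (take k B))"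
    by (simp add: start_def AB)
  have "card (set (take k X)) \<le> k" for X :: "'a list"
    using card_length[of "take k X"] by simp
  then show "start k \<subseteq> V" "card (start k) \<le> k"
    using inv set_take_subset[of k A] set_take_subset[of k B] by (auto simp: start_eq better_def)
  show "f U \<le> 16 * f (start k)" if U: "U \<subseteq> V" "card U \<le> k" for U
  proof -
    have "f ((set A \<union> U) \<union> (set B \<union> U)) + f ((set A \<union> U) \<inter> (set B \<union> U))
        \<le> f (set A \<union> U) + f (set B \<union> U)"
      using inv U by (intro union_inter_le) auto
    moreover have "(set A \<union> U) \<inter> (set B \<union> U) = U" using inv by auto
    moreover have "0 \<le> f ((set A \<union> U) \<union> (set B \<union> U))" using inv U by (intro nonneg) auto
    moreover have "f (set A \<union> U) \<le> 2 * (f (set A) + f (set B))"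
      using inv U assms by (intro saturated_union)
    moreover have "f (set B \<union> U) \<le> 2 * (f (set B) + f (set A))"
      using inv U assms by (intro saturated_union)
    moreover have "f (set A) \<le> 2 * f (set (take k A))" "f (set B) \<le> 2 * f (set (take k B))"
      using inv assms by (auto intro: growing_take)
    moreover have "f (set (take k A)) \<le> f (start k)" "f (set (take k B)) \<le> f (start k)"
      by (auto simp: start_eq better_def)
    ultimately show ?thesis by simp
  qed
qed


subsection \<open>Progress of the local search\<close>

definition near_optimal :: "'a set \<Rightarrow> real \<Rightarrow> 'a set \<Rightarrow> bool" where
  "near_optimal U \<epsilon> S \<longleftrightarrow>
     f S \<ge> (f (S \<inter> U) + f (S \<union> U)) / (2 + \<epsilon>) \<and> f S \<ge> f (S \<inter> U) / (1 + \<epsilon>)"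

lemma step_mono: "0 \<le> \<tau> \<Longrightarrow> f S \<le> f (step f k \<tau> S u)"
  using step_gain[of f k \<tau> S u] by auto

lemma removal_step:
  assumes "f S + \<tau> < f (S - {weakest f S})"
  shows "f S + \<tau> < f (step f k \<tau> S u)"
  using assms by (simp add: step_def move_def Let_def)

text \<open>A rejected candidate exceeds \<open>f S\<close> by at most \<tau>, so the threshold
  loses at most \<tau>.\<close>

lemma addition_step:
  assumes "0 \<le> \<tau>" "f (S - {weakest f S}) \<le> f S + \<tau>"
  shows "f (insert u (if card S < k then S else S - {weakest f S})) - \<tau> \<le> f (step f k \<tau> S u)"
  using assms by (auto simp: step_def move_def Let_def)

lemma removal_le_weakest:
  assumes "S \<subseteq> V"
  shows "f (S \<inter> U) - f S \<le> real (card (S - U)) * (f (S - {weakest f S}) - f S)"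
proof -
  have "f (S \<inter> U) - f S \<le> (\<Sum>v\<in>S - U. f (S - {v}) - f S)"
    by (rule removal_gain_le[OF assms])
  also have "\<dots> \<le> real (card (S - U)) * (f (S - {weakest f S}) - f S)"
    using weakest(2)[OF finite_subset_ground[OF assms], of _ f]
    by (intro sum_bounded_above) auto
  finally show ?thesis .
qed

text \<open>When \<open>S\<close> is full, a swap gains at least the plain insertion plus
  \<open>D\<close>, the change caused by deleting the weakest element. Over \<open>U - S\<close> the
  insertions account for \<open>f (S \<union> U)\<close>, and the copies of \<open>D\<close> for
  \<open>f (S \<inter> U)\<close> up to \<open>k * \<tau>\<close>; the acceptance threshold costs a
  second \<open>k * \<tau>\<close>.\<close>

lemma addition_gain:
  assumes S: "S \<subseteq> V" "card S \<le> k" and U: "U \<subseteq> V" "card U \<le> k"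
    and "0 \<le> \<tau>" and weak: "f (S - {weakest f S}) \<le> f S + \<tau>"
  shows "f (S \<union> U) + f (S \<inter> U) - 2 * f S - 2 * k * \<tau> \<le> (\<Sum>u\<in>V. f (step f k \<tau> S u) - f S)"
proof -
  define w where "w = weakest f S"
  define D where "D = f (S - {w}) - f S"
  have fin: "finite S" "finite U" using S U finite_subset_ground by auto
  have D: "D \<le> \<tau>" using weak by (simp add: D_def w_def)
  have rem: "f (S \<inter> U) - f S \<le> real (card (S - U)) * D"
    using removal_le_weakest[OF S(1)] by (simp add: D_def w_def)
  have card_le: "card (S - U) \<le> k" "card (U - S) \<le> k"
    using fin S U by (meson Diff_subset card_mono le_trans)+
  have rem': "f (S \<inter> U) - f S \<le> k * \<tau>"
  proof -
    have "real (card (S - U)) * D \<le> real (card (S - U)) * \<tau>"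
      using D by (intro mult_left_mono) auto
    also have "\<dots> \<le> k * \<tau>" using card_le assms(5) by (intro mult_right_mono) auto
    finally show ?thesis using rem by simp
  qed
  have add: "f (S \<union> U) - f S \<le> (\<Sum>u\<in>U - S. f (insert u S) - f S)"
    using S U by (intro union_gain_le) auto
  define T where "T = (\<lambda>u. insert u (if card S < k then S else S - {w}))"
  have "f (S \<union> U) + f (S \<inter> U) - 2 * f S - k * \<tau> \<le> (\<Sum>u\<in>U - S. f (T u) - f S)"
  proof (cases "card S < k")
    case True
    then show ?thesis using add rem' by (simp add: T_def)
  next
    case False
    have ins: "f (insert u S) - f S + D \<le> f (T u) - f S" if "u \<in> U - S" for u
    proof -
      have "f (insert u S) - f S \<le> f (insert u (S - {w})) - f (S - {w})"
        using that S U by (intro gain_antimono) auto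
      then show ?thesis using False by (simp add: T_def D_def)
    qed
    have "(\<Sum>u\<in>U - S. f (insert u S) - f S) + card (U - S) * D
        = (\<Sum>u\<in>U - S. f (insert u S) - f S + D)"
      by (simp add: sum.distrib)
    also have "\<dots> \<le> (\<Sum>u\<in>U - S. f (T u) - f S)"
      by (intro sum_mono ins)
    finally have *: "f (S \<union> U) - f S + card (U - S) * D \<le> (\<Sum>u\<in>U - S. f (T u) - f S)"
      using add by simp
    \<comment> \<open>A full \<open>S\<close> is at least as large as \<open>U\<close>; for negative
      \<open>D\<close> this limits how often the loss is incurred.\<close>
    have "card (U - S) \<le> card (S - U)"
      using False S U fin by (simp add: card_le_sym_Diff)
    have "f (S \<inter> U) - f S - k * \<tau> \<le> card (U - S) * D"
    proof (cases "0 \<le> D")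
      case True
      then have "0 \<le> card (U - S) * D" by simp
      then show ?thesis using rem' by linarith
    next
      case False
      then have "card (S - U) * D \<le> card (U - S) * D"
        using \<open>card (U - S) \<le> card (S - U)\<close> by (intro mult_right_mono_neg) auto
      moreover have "0 \<le> k * \<tau>" using assms(5) by simp
      ultimately show ?thesis using rem by linarith
    qed
    then show ?thesis using * by linarith
  qed
  also have "\<dots> = (\<Sum>u\<in>U - S. f (T u) - \<tau> - f S) + card (U - S) * \<tau>"
    by (simp add: sum.distrib sum_subtractf)
  also have "\<dots> \<le> (\<Sum>u\<in>U - S. f (step f k \<tau> S u) - f S) + k * \<tau>"
    using card_le assms(5)
    by (intro add_mono sum_mono mult_right_mono diff_right_mono)
      (auto simp only: T_def w_def of_nat_le_iff intro: addition_step[OF assms(5) weak])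
  \<comment> \<open>Steps never decrease \<open>f\<close>, so the other draws contribute nonnegative
    terms.\<close>
  also have "(\<Sum>u\<in>U - S. f (step f k \<tau> S u) - f S) \<le> (\<Sum>u\<in>V. f (step f k \<tau> S u) - f S)"
    using U step_mono[OF assms(5)] finite_ground by (intro sum_mono2) auto
  finally show ?thesis by (simp add: algebra_simps)
qed

text \<open>If deleting the weakest element gains more than \<tau>, every draw triggers an accepted
  deletion. Otherwise the second guarantee holds, so the first fails by more than
  \<open>\<epsilon> * f S\<close>, of which the thresholds consume at most half.\<close>

lemma not_near_optimal_gain:
  fixes \<epsilon> \<tau> :: real
  assumes S: "S \<subseteq> V" "card S \<le> k" and U: "U \<subseteq> V" "card U \<le> k"
    and "0 < \<epsilon>" "0 \<le> \<tau>" and \<tau>: "4 * k * \<tau> \<le> \<epsilon> * f S" and "V \<noteq> {}"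
    and bad: "\<not> near_optimal U \<epsilon> S"
  shows "card V * \<tau> < (\<Sum>u\<in>V. f (step f k \<tau> S u) - f S) \<or>
    \<epsilon> * f S / 2 < (\<Sum>u\<in>V. f (step f k \<tau> S u) - f S)"
proof (cases "f (S - {weakest f S}) \<le> f S + \<tau>")
  case False
  then have "(\<Sum>u\<in>V. \<tau>) < (\<Sum>u\<in>V. f (step f k \<tau> S u) - f S)"
    using removal_step[of S \<tau> k] finite_ground assms(8)
    by (intro sum_strict_mono) (auto simp: less_diff_eq add.commute not_le)
  then show ?thesis by simp
next
  case True
  have "f (S \<inter> U) - f S \<le> k * \<tau>"
  proof -
    have "f (S \<inter> U) - f S \<le> real (card (S - U)) * (f (S - {weakest f S}) - f S)"
      by (rule removal_le_weakest[OF S(1)])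
    also have "\<dots> \<le> real (card (S - U)) * \<tau>" using True by (intro mult_left_mono) auto
    also have "\<dots> \<le> k * \<tau>"
      using assms(6) S card_mono[OF finite_subset_ground[OF S(1)], of "S - U"]
      by (intro mult_right_mono) auto
    finally show ?thesis .
  qed
  moreover have "0 \<le> \<epsilon> * f S" using assms(5) nonneg[OF S(1)] by simp
  ultimately have "f (S \<inter> U) \<le> (1 + \<epsilon>) * f S" using \<tau> by (simp add: algebra_simps)
  then have "f (S \<inter> U) / (1 + \<epsilon>) \<le> f S" using assms(5) by (simp add: divide_le_eq mult.commute)
  then have "(2 + \<epsilon>) * f S < f (S \<inter> U) + f (S \<union> U)"
    using bad assms(5) by (simp add: near_optimal_def divide_le_eq mult.commute not_le)
  then have "\<epsilon> * f S / 2 < f (S \<union> U) + f (S \<inter> U) - 2 * f S - 2 * k * \<tau>"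
    using \<tau> by (simp add: algebra_simps)
  then show ?thesis using addition_gain[OF S U assms(6) True] by linarith
qed

end


subsection \<open>Stopping at a random time\<close>

lemma prob_bind_pmf_of_set:
  assumes "finite A" "A \<noteq> {}"
  shows "measure_pmf.prob (bind_pmf (pmf_of_set A) h) X = (\<Sum>a\<in>A. measure_pmf.prob (h a) X) / card A"
proof -
  \<comment> \<open>As a point mass at \<open>True\<close>, the probability of a bind becomes an
    average via \<open>pmf_bind\<close>.\<close>
  have *: "measure_pmf.prob p X = pmf (map_pmf (\<lambda>x. x \<in> X) p) True" for p
    by (auto simp: pmf_map vimage_def)
  show ?thesis
    unfolding * map_bind_pmf by (simp add: pmf_bind integral_pmf_of_set assms)
qed

text \<open>Each visit to a bad state raises the potential by at least \<^term>\<open>g\<close> on average, so the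
  expected number of visits is bounded by the available potential.\<close>

lemma sum_visit_prob_le:
  fixes nxt :: "'s \<Rightarrow> 'a \<Rightarrow> 's" and \<phi> :: "'s \<Rightarrow> real" and g F :: real
  assumes V: "finite V" "V \<noteq> {}"
    and inv: "\<And>S u. Inv S \<Longrightarrow> u \<in> V \<Longrightarrow> Inv (nxt S u)"
    and mono: "\<And>S u. Inv S \<Longrightarrow> u \<in> V \<Longrightarrow> \<phi> S \<le> \<phi> (nxt S u)"
    and gain: "\<And>S. Inv S \<Longrightarrow> Bad S \<Longrightarrow> card V * g \<le> (\<Sum>u\<in>V. \<phi> (nxt S u) - \<phi> S)"
    and bound: "\<And>S. Inv S \<Longrightarrow> \<phi> S \<le> F"
    and "Inv S"
  shows "g * (\<Sum>i<m. measure_pmf.prob (replicate_pmf i (pmf_of_set V)) {us. Bad (foldl nxt S us)})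
    \<le> F - \<phi> S"
  using \<open>Inv S\<close>
proof (induction m arbitrary: S)
  case 0
  then show ?case using bound by simp
next
  case (Suc m)
  define p where "p = (\<lambda>i S. measure_pmf.prob (replicate_pmf i (pmf_of_set V)) {us. Bad (foldl nxt S us)})"
  have n: "0 < card V" using V by (simp add: card_gt_0_iff)
  have p0: "p 0 S = of_bool (Bad S)" by (simp add: p_def indicator_def)
  \<comment> \<open>Condition on the first drawn element.\<close>
  have pSuc: "p (Suc i) S = (\<Sum>u\<in>V. p i (nxt S u)) / card V" for i
  proof -
    have "measure_pmf.prob (bind_pmf (replicate_pmf i (pmf_of_set V)) (\<lambda>us. return_pmf (u # us)))
        {us. Bad (foldl nxt S us)} = p i (nxt S u)" for u
      by (simp add: p_def map_pmf_def[symmetric] vimage_def)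
    then show ?thesis
      by (simp add: p_def prob_bind_pmf_of_set[OF V])
  qed
  \<comment> \<open>At a good state this is just monotonicity of the potential.\<close>
  have "card V * (g * of_bool (Bad S)) \<le> (\<Sum>u\<in>V. \<phi> (nxt S u) - \<phi> S)"
    using gain[OF Suc.prems] sum_nonneg[of V "\<lambda>u. \<phi> (nxt S u) - \<phi> S"] mono[OF Suc.prems] by auto
  moreover have "(\<Sum>u\<in>V. g * (\<Sum>i<m. p i (nxt S u))) \<le> (\<Sum>u\<in>V. F - \<phi> (nxt S u))"
    using Suc.IH inv[OF Suc.prems] by (intro sum_mono) (auto simp: p_def)
  moreover have "(\<Sum>u\<in>V. \<phi> (nxt S u) - \<phi> S) + (\<Sum>u\<in>V. F - \<phi> (nxt S u)) = card V * (F - \<phi> S)"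
    by (simp flip: sum.distrib)
  moreover have sum_p: "(\<Sum>i<Suc m. p i S) = of_bool (Bad S) + (\<Sum>u\<in>V. \<Sum>i<m. p i (nxt S u)) / card V"
    unfolding sum.lessThan_Suc_shift p0 pSuc sum_divide_distrib[symmetric]
    by (subst sum.swap) simp
  have "card V * (g * (\<Sum>i<Suc m. p i S)) =
      card V * (g * of_bool (Bad S)) + (\<Sum>u\<in>V. g * (\<Sum>i<m. p i (nxt S u)))"
    unfolding sum_p sum_distrib_left[symmetric] using n by (simp add: distrib_left)
  ultimately have "card V * (g * (\<Sum>i<Suc m. p i S)) \<le> card V * (F - \<phi> S)" by linarith
  then show ?case using n by (simp add: p_def)
qed

subsection \<open>Analysis of the complete algorithm\<close>

context nonneg_submodular
begin

lemma qt_local_search_tree: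
  fixes \<epsilon> :: real
  assumes "0 < k"
  defines "\<tau> \<equiv> \<epsilon> * f (start k) / (4 * k)"
  shows "qt_output f (local_search_tree V k \<epsilon> us) = foldl (step f k \<tau>) (start k) us"
    and "qt_queries f (local_search_tree V k \<epsilon> us) = 4 * card V + 2 + card (start k)
      + qt_queries f (search k \<tau> us (start k) (weakest f (start k)))"
proof -
  obtain A B where AB: "fold (place f k) (enum V) ([], []) = (A, B)" by force
  define S where "S = start k"
  define g where "g = table f [set (take k A), set (take k B)]"
  have S: "S = better f (set (take k A)) (set (take k B))"
    by (simp add: S_def start_def AB)
  have g: "better g (set (take k A)) (set (take k B)) = S" "g S = f S"
    by (auto simp: S g_def table_def better_def)
  have fin: "finite S" using start[OF assms(1)] finite_subset_ground by (simp add: S_def)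
  show "qt_output f (local_search_tree V k \<epsilon> us) = foldl (step f k \<tau>) (start k) us"
    by (simp add: local_search_tree_def qt_scan AB g weakest_table[OF fin] qt_output_search[OF fin]
        \<tau>_def flip: S_def g_def)
  show "qt_queries f (local_search_tree V k \<epsilon> us) = 4 * card V + 2 + card (start k)
      + qt_queries f (search k \<tau> us (start k) (weakest f (start k)))"
    by (simp add: local_search_tree_def qt_scan AB g weakest_table[OF fin] length_enum[OF fin]
        length_enum[OF finite_ground] \<tau>_def flip: S_def g_def)
qed

lemma qt_queries_local_search_tree:
  fixes \<epsilon> :: real
  assumes "0 < k" "0 < \<epsilon>" "set us \<subseteq> V" "length us \<le> 64 * real (card V + k) / \<epsilon>\<^sup>2"
  shows "qt_queries f (local_search_tree V k \<epsilon> us)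
    \<le> (7 + 256 / \<epsilon>\<^sup>2 + 64 / \<epsilon>) * (real (card V) + real k ^ 2)"
proof -
  define S where "S = start k"
  define \<tau> where "\<tau> = \<epsilon> * f S / (4 * k)"
  define N where "N = real (card V) + real k ^ 2"
  note S = start[OF assms(1), folded S_def]
  have pos: "0 \<le> f S" using S(1) by (rule nonneg)
  have "real k * 1 \<le> real k * real k" using assms(1) by (intro mult_left_mono) auto
  then have k: "real k \<le> real k ^ 2" by (simp add: power2_eq_square)
  have "1 \<le> real k" using assms(1) by simp
  with k have N: "1 \<le> N" "real k \<le> N" "real (card V + k) \<le> N" "real k ^ 2 \<le> N" "card V \<le> N"
    unfolding N_def of_nat_add using of_nat_0_le_iff[of "card V"] by linarith+
  have "real (qt_queries f (search k \<tau> us S (weakest f S))) \<le> 4 * real (length us) + real k * (64 * real k / \<epsilon>)"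
  \<comment> \<open>The budget is \<open>M = 64 * k / \<epsilon>\<close> because
    \<open>M * \<tau>\<close> equals the upper bound \<open>16 * f S\<close> on all feasible
    values.\<close>
  proof (rule qt_queries_search[where V = V and F = "16 * f S"])
    show "16 * f S - f S \<le> 64 * real k / \<epsilon> * \<tau>"
      using assms pos by (simp add: \<tau>_def)
  qed (use assms S pos finite_ground in \<open>auto simp: \<tau>_def\<close>)
  also have "4 * real (length us) \<le> 4 * (64 * N / \<epsilon>\<^sup>2)"
  proof -
    have "64 * real (card V + k) / \<epsilon>\<^sup>2 \<le> 64 * N / \<epsilon>\<^sup>2"
      using N by (intro divide_right_mono) auto
    with assms(4) show ?thesis by simp
  qed
  also have "real k * (64 * real k / \<epsilon>) \<le> 64 * N / \<epsilon>"
    using N assms(2) by (simp add: power2_eq_square divide_right_mono)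
  finally have "real (qt_queries f (search k \<tau> us S (weakest f S)))
      \<le> 256 / \<epsilon>\<^sup>2 * N + 64 / \<epsilon> * N"
    by simp
  \<comment> \<open>7 = 4 + 2 + 1, using \<open>1 \<le> N\<close> and
    \<open>card S \<le> k \<le> N\<close>.\<close>
  moreover have "real (4 * card V + 2 + card S) \<le> 7 * N"
  proof -
    have "real (card S) \<le> N" using S(2) N(2) by linarith
    then show ?thesis using N by simp
  qed
  ultimately show ?thesis
    unfolding qt_local_search_tree(2)[OF assms(1)] N_def[symmetric]
    by (simp add: S_def \<tau>_def algebra_simps)
qed

lemma prob_not_near_optimal:
  fixes \<epsilon> :: real
  assumes "0 < k" "0 < \<epsilon>" "V \<noteq> {}" "U \<subseteq> V" "card U \<le> k"
    and m: "64 * real (card V + k) / \<epsilon>\<^sup>2 \<le> real m"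
  defines "\<tau> \<equiv> \<epsilon> * f (start k) / (4 * k)"
  shows "(\<Sum>i<m. measure_pmf.prob (replicate_pmf i (pmf_of_set V))
      {us. \<not> near_optimal U \<epsilon> (foldl (step f k \<tau>) (start k) us)}) \<le> \<epsilon> * m"
    (is "?P \<le> _")
proof -
  define n where "n = real (card V)"
  define S0 where "S0 = start k"
  note S0 = start[OF assms(1), folded S0_def]
  have n: "0 < n" using assms(3) finite_ground by (simp add: n_def card_gt_0_iff)
  have pos: "0 \<le> f S0" using S0(1) by (rule nonneg)
  have \<tau>: "\<tau> = \<epsilon> * f S0 / (4 * k)" "0 \<le> \<tau>"
    using pos assms by (auto simp: \<tau>_def S0_def)
  \<comment> \<open>The clause \<open>f S0 \<le> f S\<close> lets a threshold fixed from
    \<open>S0\<close> be compared with the current value.\<close>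
  define Inv where "Inv = (\<lambda>S. S \<subseteq> V \<and> card S \<le> k \<and> f S0 \<le> f S)"
  have inv: "Inv (step f k \<tau> S u)" if "Inv S" "u \<in> V" for S u
    using that step_feasible[OF finite_ground that(2), where f = f and \<tau> = \<tau>] assms(1) step_mono[OF \<tau>(2), of S k u]
    by (auto simp: Inv_def)
  have gain: "n * \<tau> < (\<Sum>u\<in>V. f (step f k \<tau> S u) - f S) \<or>
      \<epsilon> * f S0 / 2 < (\<Sum>u\<in>V. f (step f k \<tau> S u) - f S)"
    if "Inv S" "\<not> near_optimal U \<epsilon> S" for S
  proof -
    have le: "\<epsilon> * f S0 \<le> \<epsilon> * f S" using that assms(2) by (simp add: Inv_def)
    have "4 * real k * \<tau> \<le> \<epsilon> * f S" using le assms(1) by (simp add: \<tau>)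
    from not_near_optimal_gain[OF _ _ assms(4,5,2) \<tau>(2) this assms(3) that(2)] that(1) le
    show ?thesis by (auto simp: Inv_def n_def)
  qed
  have visits: "g * ?P \<le> 16 * f S0 - f S0"
    if "\<And>S. Inv S \<Longrightarrow> \<not> near_optimal U \<epsilon> S \<Longrightarrow> n * g \<le> (\<Sum>u\<in>V. f (step f k \<tau> S u) - f S)" for g
    unfolding S0_def[symmetric]
  proof (rule sum_visit_prob_le[where Inv = Inv])
    show "Inv S0" using S0 by (simp add: Inv_def)
  qed (use that inv step_mono[OF \<tau>(2)] S0(3) finite_ground assms(3) in \<open>auto simp: Inv_def n_def\<close>)
  show ?thesis
  proof (cases "f S0 = 0")
    \<comment> \<open>Here \<tau> is 0 and no feasible value is positive. A bad set would force a
      strict increase, so none is reachable and any factor works in \<open>visits\<close>.\<close>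
    case True
    have "near_optimal U \<epsilon> S" if "Inv S" for S
    proof (rule ccontr)
      assume "\<not> near_optimal U \<epsilon> S"
      from gain[OF that this] True have "0 < (\<Sum>u\<in>V. f (step f k \<tau> S u) - f S)"
        by (auto simp: \<tau>)
      moreover have "f (step f k \<tau> S u) - f S \<le> 0" if "u \<in> V" for u
        using inv[OF \<open>Inv S\<close> that] S0(3)[of "step f k \<tau> S u"] \<open>Inv S\<close> True by (auto simp: Inv_def)
      then have "(\<Sum>u\<in>V. f (step f k \<tau> S u) - f S) \<le> 0" by (intro sum_nonpos)
      ultimately show False by simp
    qed
    then have "1 * ?P \<le> 16 * f S0 - f S0" by (intro visits) auto
    then have "?P \<le> 0" using True by simp
    also have "0 \<le> \<epsilon> * m" using assms(2) by simp
    finally show ?thesis .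
  next
    case False
    with pos have pos: "0 < f S0" by simp
    \<comment> \<open>Chosen so that \<open>n * g\<close> lies below both alternatives of
      \<open>gain\<close>: \<open>g \<le> \<tau>\<close> and
      \<open>n * g \<le> \<epsilon> * f S0 / 2\<close>.\<close>
    define g where "g = \<epsilon> * f S0 / (4 * (n + k))"
    have g: "0 < g" using pos n assms(2) by (simp add: g_def)
    have "n * g \<le> \<epsilon> * f S0 / 2"
    proof -
      have "n * g = \<epsilon> * f S0 / 2 * (n / (2 * (n + k)))" by (simp add: g_def)
      also have "\<dots> \<le> \<epsilon> * f S0 / 2 * 1"
        using n pos assms(2) by (intro mult_left_mono) (auto simp: divide_le_eq)
      finally show ?thesis by simp
    qed
    moreover have "n * g \<le> n * \<tau>"
      using n pos assms(1,2) unfolding g_def \<tau> by (intro mult_left_mono divide_left_mono) auto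
    ultimately have "n * g \<le> (\<Sum>u\<in>V. f (step f k \<tau> S u) - f S)"
      if "Inv S" "\<not> near_optimal U \<epsilon> S" for S
      using gain[OF that] by linarith
    from visits[OF this] have "g * ?P \<le> 16 * f S0" using pos by linarith
    also have "\<dots> = g * (\<epsilon> * (64 * (n + k) / \<epsilon>\<^sup>2))"
    proof -
      have "\<epsilon> * f S0 / (4 * N) * (\<epsilon> * (64 * N / \<epsilon>\<^sup>2)) = 16 * f S0" if "0 < N" for N
        using that assms(2) by (simp add: power2_eq_square)
      from this[of "n + k"] show ?thesis using n by (simp add: g_def)
    qed
    also have "\<dots> \<le> g * (\<epsilon> * m)"
      using m g assms(2) by (intro mult_left_mono) (auto simp: n_def)
    finally show ?thesis using g by simp
  qed
qed

end

theorem mainTheorem2: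
  shows "\<exists>(Alg :: 'a set \<Rightarrow> nat \<Rightarrow> real \<Rightarrow> 'a qtree pmf) (C :: real \<Rightarrow> real).
    \<forall>V k \<epsilon> f. finite V \<and> k > 0 \<and> 0 < \<epsilon> \<and> \<epsilon> < 1 \<and> nonneg_on V f \<and> submodular_on V f \<longrightarrow>
      (\<forall>t \<in> set_pmf (Alg V k \<epsilon>).
         qt_output f t \<subseteq> V \<and> card (qt_output f t) \<le> k \<and>
         real (qt_queries f t) \<le> C \<epsilon> * (real (card V) + real k ^ 2)) \<and>
      (\<forall>OPT. is_opt V k f OPT \<longrightarrow>
         measure_pmf.prob (Alg V k \<epsilon>)
           {t. f (qt_output f t) \<ge> (f (qt_output f t \<inter> OPT) + f (qt_output f t \<union> OPT)) / (2 + \<epsilon>)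
             \<and> f (qt_output f t) \<ge> f (qt_output f t \<inter> OPT) / (1 + \<epsilon>)} \<ge> 1 - \<epsilon>)"
proof (intro exI[of _ local_search] exI[of _ "\<lambda>\<epsilon>. 7 + 256 / \<epsilon>\<^sup>2 + 64 / \<epsilon>"] allI impI, goal_cases)
  case (1 V k \<epsilon> f)
  then interpret nonneg_submodular V f by unfold_locales auto
  have k: "0 < k" and \<epsilon>: "0 < \<epsilon>" "\<epsilon> < 1" using 1 by auto
  show ?case
  proof (cases "V = {}")
    case True
    have "0 \<le> f {}" using nonneg by simp
    then have "f {} / (1 + \<epsilon>) \<le> f {}" "2 * f {} / (2 + \<epsilon>) \<le> f {}"
      using \<epsilon> by (auto simp: divide_le_eq algebra_simps)
    then show ?thesis
      using True \<epsilon> by (auto simp: local_search_def is_opt_def)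
  next
    case False
    define \<tau> where "\<tau> = \<epsilon> * f (start k) / (4 * k)"
    define m where "m = num_steps V k \<epsilon>"
    define R where "R = (\<lambda>i. replicate_pmf i (pmf_of_set V))"
    have pos: "0 < 64 * real (card V + k) / \<epsilon>\<^sup>2" using k \<epsilon> by simp
    \<comment> \<open>Since \<open>m\<close> is a ceiling, a natural number below it is also below
      the real bound.\<close>
    have m: "0 < m" "64 * real (card V + k) / \<epsilon>\<^sup>2 \<le> m"
      "\<And>i. i < m \<Longrightarrow> i \<le> 64 * real (card V + k) / \<epsilon>\<^sup>2"
      using pos unfolding m_def num_steps_def by linarith+
    have Alg: "local_search V k \<epsilon> = bind_pmf (pmf_of_set {..<m}) (\<lambda>i. map_pmf (local_search_tree V k \<epsilon>) (R i))"
      using False by (simp add: local_search_def m_def R_def)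
    have set_R: "set us \<subseteq> V \<and> length us = i" if "us \<in> set_pmf (R i)" for us i
      using that False finite_ground by (auto simp: R_def set_replicate_pmf)
    have out: "qt_output f (local_search_tree V k \<epsilon> us) = foldl (step f k \<tau>) (start k) us" for us
      using qt_local_search_tree(1)[OF k] by (simp add: \<tau>_def)
    have feasible: "qt_output f t \<subseteq> V \<and> card (qt_output f t) \<le> k \<and>
        real (qt_queries f t) \<le> (7 + 256 / \<epsilon>\<^sup>2 + 64 / \<epsilon>) * (real (card V) + real k ^ 2)"
      if t: "t \<in> set_pmf (local_search V k \<epsilon>)" for t
    proof -
      have "{..<m} \<noteq> {}" using m(1) by auto
      with t obtain i us where i: "i < m" and us: "us \<in> set_pmf (R i)"
        and t_eq: "t = local_search_tree V k \<epsilon> us"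
        by (auto simp: Alg)
      have "length us \<le> 64 * real (card V + k) / \<epsilon>\<^sup>2" using set_R[OF us] m(3)[OF i] by simp
      with foldl_step_feasible[OF finite_ground _ start(1,2)[OF k] k, where us = us and f = f and \<tau> = \<tau>]
        qt_queries_local_search_tree[OF k \<epsilon>(1), of us] set_R[OF us]
      show ?thesis by (simp add: t_eq out)
    qed
    have "1 - \<epsilon> \<le> measure_pmf.prob (local_search V k \<epsilon>) {t. near_optimal U \<epsilon> (qt_output f t)}"
      if "is_opt V k f U" for U
    proof -
      have U: "U \<subseteq> V" "card U \<le> k" using that by (auto simp: is_opt_def)
      \<comment> \<open>The uniform stopping time turns the failure probability into the average of
        the first \<open>m\<close> bad-visit probabilities.\<close>
      have "measure_pmf.prob (local_search V k \<epsilon>) {t. \<not> near_optimal U \<epsilon> (qt_output f t)} =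
          (\<Sum>i<m. measure_pmf.prob (R i) {us. \<not> near_optimal U \<epsilon> (foldl (step f k \<tau>) (start k) us)}) / m"
        using m(1) unfolding Alg
        by (subst prob_bind_pmf_of_set) (auto simp: vimage_def out)
      also have "\<dots> \<le> \<epsilon>"
        using prob_not_near_optimal[OF k \<epsilon>(1) False U m(2)] m(1)
        by (simp add: divide_le_eq R_def \<tau>_def)
      finally show ?thesis
        using measure_pmf.prob_compl[of "{t. near_optimal U \<epsilon> (qt_output f t)}" "local_search V k \<epsilon>"]
        by (simp add: Collect_neg_eq Compl_eq_Diff_UNIV)
    qed
    with feasible show ?thesis unfolding near_optimal_def by blast
  qed
qed

end
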